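(* Let $\mathbf{x}:(U,0)\to(\mathbb{R}^3,0)$ be a germ of a wavefront, $\mathbf{\Omega}$ a tangent moving basis of $\mathbf{x}$ and $0\in\Sigma(\mathbf{x})$ with $\mathrm{rank}(D\mathbf{x}(0))=0$. Then, up to an isometry of $\mathbb{R}^3$, $\mathbf{x}$ is $\mathscr{R}$-equivalent to $$\mathbf{y}(u,v)=\Big(h_u,\ h_v,\ \int_0^u\big(t_1h_{uu}(t_1,v)+v\,h_{vu}(t_1,v)\big)\,dt_1+\int_0^v t_2h_{vv}(0,t_2)\,dt_2\Big),$$ where $h$ is a smooth function defined on some neighborhood of $(0,0)$ with $h_{uu}(0)=h_{uv}(0)=h_{vv}(0)=0$.
   Context: All maps are $C^\infty$ and $U\subset\mathbb{R}^2$ is open. $D$ denotes the Jacobian matrix. A tangent moving basis (tmb) of $\mathbf{x}:U\to\mathbb{R}^3$ is a smooth map $\mathbf{\Omega}=(\mathbf{w}_1\ \mathbf{w}_2):U\to\mathcal{M}_{3\times2}(\mathbb{R})$ with columns linearly independent at every point and $\mathbf{x}_u,\mathbf{x}_v\in\mathrm{span}(\mathbf{w}_1,\mathbf{w}_2)$. The map $\mathbf{x}$ is a frontal if near each point $p$ there is a smooth unit vector field $\mathbf{n}_p$ orthogonal to $\mathbf{x}_u,\mathbf{x}_v$ (equivalently, tmbs exist locally; a global tmb is always assumed), and a wavefront if moreover each $(\mathbf{x},\mathbf{n}_p)$ is an immersion into $\mathbb{R}^3\times S^2$. $\Sigma(\mathbf{x})$ is the set of points where $\mathbf{x}$ is not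 immersive. Two map germs $\mathbf{f}_1:(U_1,p)\to(\mathbb{R}^n,q)$, $\mathbf{f}_2:(U_2,p)\to(\mathbb{R}^n,q)$ are $\mathscr{R}$-equivalent if $\mathbf{f}_2=\mathbf{f}_1\circ\mathbf{h}$ for a diffeomorphism germ $\mathbf{h}:(U_2,p)\to(U_1,p)$. "Up to an isometry" means after composing $\mathbf{x}$ on the left with an isometry of $\mathbb{R}^3$. *)

theory Defs
  imports "HOL-Analysis.Analysis"
begin

subsection \<open>Smooth maps on open subsets\<close>

text \<open>The sets \<open>S\<close> below are meant to be open, so that the derivative \<open>at x\<close> only depends on
  the values of \<open>f\<close> on \<open>S\<close>.\<close>

primrec Ck_on :: "nat \<Rightarrow> 'a::real_normed_vector set \<Rightarrow> ('a \<Rightarrow> 'b::real_normed_vector) \<Rightarrow> bool" where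
  "Ck_on 0 S f \<longleftrightarrow> continuous_on S f"
| "Ck_on (Suc k) S f \<longleftrightarrow>
     (\<forall>x\<in>S. f differentiable (at x)) \<and> (\<forall>v. Ck_on k S (\<lambda>x. frechet_derivative f (at x) v))"

definition smooth_on :: "'a::real_normed_vector set \<Rightarrow> ('a \<Rightarrow> 'b::real_normed_vector) \<Rightarrow> bool" where
  "smooth_on S f \<longleftrightarrow> (\<forall>k. Ck_on k S f)"

text \<open>With \<open>u\<close>, \<open>v\<close> the first and second coordinate, \<open>f\<^sub>u\<close> is \<open>partial_deriv 1 f\<close>, \<open>f\<^sub>v\<close> is
  \<open>partial_deriv 2 f\<close>, and iterated subscripts are read from left to right:
  \<open>f\<^sub>v\<^sub>u\<close> is \<open>partial_deriv 1 (partial_deriv 2 f)\<close>.\<close>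

definition partial_deriv :: "'n::finite \<Rightarrow> (real^'n \<Rightarrow> 'b::real_normed_vector) \<Rightarrow> real^'n \<Rightarrow> 'b" where
  "partial_deriv i f p = frechet_derivative f (at p) (axis i 1)"

definition immersive_at :: "('a::real_normed_vector \<Rightarrow> 'b::real_normed_vector) \<Rightarrow> 'a \<Rightarrow> bool" where
  "immersive_at f p \<longleftrightarrow> inj (frechet_derivative f (at p))"

definition immersion_on :: "'a::real_normed_vector set \<Rightarrow> ('a \<Rightarrow> 'b::real_normed_vector) \<Rightarrow> bool" where
  "immersion_on S f \<longleftrightarrow> smooth_on S f \<and> (\<forall>p\<in>S. immersive_at f p)"

subsection \<open>Frontals and wavefronts\<close>

text \<open>The inequality of the columns is needed because \<open>independent\<close> is a predicate on sets.\<close>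

definition tangent_moving_basis ::
    "(real^2) set \<Rightarrow> (real^2 \<Rightarrow> real^3) \<Rightarrow> (real^2 \<Rightarrow> real^2^3) \<Rightarrow> bool" where
  "tangent_moving_basis U x \<Omega> \<longleftrightarrow>
     smooth_on U \<Omega> \<and>
     (\<forall>p\<in>U. column 1 (\<Omega> p) \<noteq> column 2 (\<Omega> p) \<and>
            independent {column 1 (\<Omega> p), column 2 (\<Omega> p)} \<and>
            partial_deriv 1 x p \<in> span {column 1 (\<Omega> p), column 2 (\<Omega> p)} \<and>
            partial_deriv 2 x p \<in> span {column 1 (\<Omega> p), column 2 (\<Omega> p)})"

definition unit_normal_field_on ::
    "(real^2) set \<Rightarrow> (real^2 \<Rightarrow> real^3) \<Rightarrow> (real^2 \<Rightarrow> real^3) \<Rightarrow> bool" where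
  "unit_normal_field_on V x n \<longleftrightarrow>
     smooth_on V n \<and>
     (\<forall>p\<in>V. norm (n p) = 1 \<and> orthogonal (n p) (partial_deriv 1 x p) \<and>
            orthogonal (n p) (partial_deriv 2 x p))"

definition frontal_on :: "(real^2) set \<Rightarrow> (real^2 \<Rightarrow> real^3) \<Rightarrow> bool" where
  "frontal_on U x \<longleftrightarrow>
     smooth_on U x \<and>
     (\<forall>p\<in>U. \<exists>V n. open V \<and> p \<in> V \<and> V \<subseteq> U \<and> unit_normal_field_on V x n)"

text \<open>As \<open>S\<^sup>2\<close> is an embedded submanifold of \<open>\<real>\<^sup>3\<close>, a map into \<open>\<real>\<^sup>3 \<times> S\<^sup>2\<close> is an immersion
  iff it is one as a map into \<open>\<real>\<^sup>3 \<times> \<real>\<^sup>3\<close>.\<close>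

definition wavefront_on :: "(real^2) set \<Rightarrow> (real^2 \<Rightarrow> real^3) \<Rightarrow> bool" where
  "wavefront_on U x \<longleftrightarrow>
     smooth_on U x \<and>
     (\<forall>p\<in>U. \<exists>V n. open V \<and> p \<in> V \<and> V \<subseteq> U \<and> unit_normal_field_on V x n \<and>
                  immersion_on V (\<lambda>z. (x z, n z)))"

lemma wavefront_on_imp_frontal_on: "wavefront_on U x \<Longrightarrow> frontal_on U x"
  unfolding wavefront_on_def frontal_on_def by blast

definition singular_set :: "(real^2) set \<Rightarrow> (real^2 \<Rightarrow> real^3) \<Rightarrow> (real^2) set" where
  "singular_set U x = {p \<in> U. \<not> immersive_at x p}"

subsection \<open>Equivalence of germs\<close>

text \<open>Germs at \<open>p\<close> are represented by total functions of which only the values near \<open>p\<close> matter.\<close>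

definition diffeo_germ :: "'a::real_normed_vector \<Rightarrow> ('a \<Rightarrow> 'a) \<Rightarrow> bool" where
  "diffeo_germ p \<phi> \<longleftrightarrow>
     \<phi> p = p \<and>
     (\<exists>V W \<psi>. open V \<and> p \<in> V \<and> open W \<and> homeomorphism V W \<phi> \<psi> \<and>
              smooth_on V \<phi> \<and> smooth_on W \<psi>)"

definition R_equivalent :: "'a::real_normed_vector \<Rightarrow> ('a \<Rightarrow> 'b) \<Rightarrow> ('a \<Rightarrow> 'b) \<Rightarrow> bool" where
  "R_equivalent p f\<^sub>1 f\<^sub>2 \<longleftrightarrow>
     (\<exists>\<phi>. diffeo_germ p \<phi> \<and> (\<forall>\<^sub>F z in nhds p. f\<^sub>2 z = f\<^sub>1 (\<phi> z)))"

definition isometry :: "('a::metric_space \<Rightarrow> 'a) \<Rightarrow> bool" where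
  "isometry T \<longleftrightarrow> surj T \<and> (\<forall>a b. dist (T a) (T b) = dist a b)"

subsection \<open>The normal form\<close>

text \<open>The interval integrals are oriented, so negative coordinates are covered. For \<open>h\<close> smooth
  near the origin, the germ of this map at the origin depends only on the germ of \<open>h\<close>.\<close>

definition wavefront_normal_form :: "(real^2 \<Rightarrow> real) \<Rightarrow> real^2 \<Rightarrow> real^3" where
  "wavefront_normal_form h p =
     (let u = p $ 1; v = p $ 2;
          h_u = partial_deriv 1 h; h_v = partial_deriv 2 h;
          h_uu = partial_deriv 1 h_u; h_vu = partial_deriv 1 h_v; h_vv = partial_deriv 2 h_v
      in vector
           [h_u p,
            h_v p,
            (LBINT t=0..ereal u. t * h_uu (vector [t, v]) + v * h_vu (vector [t, v])) +
            (LBINT t=0..ereal v. t * h_vv (vector [0, t]))])"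

end

theory Submission
  imports Defs
begin

text \<open>Let \<open>n\<close> be a unit normal field near the origin. Since \<open>Dx\<close> vanishes at the origin while
  \<open>(x, n)\<close> is an immersion, \<open>Dn\<close> is injective there: the Gauss map is a local diffeomorphism
  onto the sphere. After a rotation or reflection \<open>T\<close> of space the normal \<open>T n\<close> is vertical at the
  origin, so near it \<open>T n\<close> is proportional to \<open>(\<phi>\<^sub>1, \<phi>\<^sub>2, -1)\<close>, and the slope \<open>\<phi>\<close> of the tangent
  plane is a local chart (\<open>normal_slope_chart\<close>). This chart, whose inverse \<open>\<psi>\<close> is smooth by
  \<open>smooth_inverse_function_theorem\<close>, is the coordinate change of the theorem.

  Indeed, let \<open>y = T \<circ> x \<circ> \<psi>\<close> and let \<open>(u, v)\<close> be the new coordinates. Orthogonality of the normal to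
  the derivative reads \<open>dy\<^sub>3 = u dy\<^sub>1 + v dy\<^sub>2\<close>. Hence the Legendre transform
  \<open>h = u y\<^sub>1 + v y\<^sub>2 - y\<^sub>3\<close> satisfies \<open>dh = y\<^sub>1 du + y\<^sub>2 dv\<close>, that is \<open>h\<^sub>u = y\<^sub>1\<close> and \<open>h\<^sub>v = y\<^sub>2\<close>
  (\<open>partial_deriv_legendre\<close>), and the second derivatives of \<open>h\<close> vanish at the origin together with
  \<open>Dy\<close>. Integrating \<open>dy\<^sub>3 = u dh\<^sub>u + v dh\<^sub>v\<close> along the path from the origin over \<open>(0, v)\<close> to \<open>(u, v)\<close>
  gives the third coordinate of the normal form (\<open>wavefront_normal_form_eq\<close>).

  The smooth inverse function theorem rests on the closure of \<open>Ck_on\<close> under algebraic operations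
  and composition. Each of these closure properties is proved by induction on the order, with the
  rule of calculus for the operation as the inductive step.\<close>

section \<open>Calculus of smooth maps\<close>

lemma Ck_on_cong:
  assumes "open S" "\<And>x. x \<in> S \<Longrightarrow> f x = g x" "Ck_on k S f"
  shows "Ck_on k S g"
  using assms(2,3)
proof (induction k arbitrary: f g)
  case 0
  then show ?case by (simp cong: continuous_on_cong)
next
  case (Suc k)
  have d: "(g has_derivative frechet_derivative f (at x)) (at x)" if "x \<in> S" for x
    by (rule has_derivative_transform_within_open[OF _ \<open>open S\<close> that Suc.prems(1)])
       (use Suc.prems(2) that in \<open>auto simp: frechet_derivative_works\<close>)
  have e: "frechet_derivative f (at x) v = frechet_derivative g (at x) v" if "x \<in> S" for x v
    using frechet_derivative_at[OF d[OF that]] by simp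
  show ?case
    using d Suc.IH[OF e] Suc.prems(2) by (auto simp: differentiable_def)
qed

text \<open>\<open>frechet_derivative\<close> is defined by choice and awkward to compute. By uniqueness of the derivative
  any formula \<open>f'\<close> for it will do, which reduces the inductive step of each closure property to a
  rule of calculus.\<close>

lemma Ck_on_SucI:
  assumes "open S" "\<And>x. x \<in> S \<Longrightarrow> (f has_derivative f' x) (at x)"
    and "\<And>v. Ck_on k S (\<lambda>x. f' x v)"
  shows "Ck_on (Suc k) S f"
proof -
  have "f' x v = frechet_derivative f (at x) v" if "x \<in> S" for x v
    using frechet_derivative_at[OF assms(2)[OF that]] by simp
  then have "Ck_on k S (\<lambda>x. frechet_derivative f (at x) v)" for v
    by (rule Ck_on_cong[OF assms(1) _ assms(3)])
  then show ?thesis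
    using assms(2) by (auto simp: differentiable_def)
qed

lemma Ck_on_Suc_has_derivative:
  "Ck_on (Suc k) S f \<Longrightarrow> x \<in> S \<Longrightarrow> (f has_derivative frechet_derivative f (at x)) (at x)"
  by (simp add: frechet_derivative_works)

lemma Ck_on_Suc_imp: "Ck_on (Suc k) S f \<Longrightarrow> Ck_on k S f"
proof (induction k arbitrary: f)
  case 0
  then show ?case
    by (auto intro!: continuous_at_imp_continuous_on differentiable_imp_continuous_within)
next
  case (Suc k)
  then show ?case by (metis Ck_on.simps(2))
qed

lemma Ck_on_const: "open S \<Longrightarrow> Ck_on k S (\<lambda>x. c)"
  by (induction k arbitrary: c) auto

lemma Ck_on_ident: "open S \<Longrightarrow> Ck_on k S (\<lambda>x. x)"
  by (cases k) (auto simp: Ck_on_const)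

lemma Ck_on_subset: "Ck_on k S f \<Longrightarrow> T \<subseteq> S \<Longrightarrow> Ck_on k T f"
  by (induction k arbitrary: f) (auto intro: continuous_on_subset)

lemma Ck_on_linear:
  assumes "open S" "bounded_linear L" "Ck_on k S f"
  shows "Ck_on k S (\<lambda>x. L (f x))"
  using assms(3)
proof (induction k arbitrary: f)
  case 0
  then show ?case by (simp add: bounded_linear.continuous_on[OF assms(2)])
next
  case (Suc k)
  show ?case
    by (rule Ck_on_SucI[OF assms(1)
          bounded_linear.has_derivative[OF assms(2) Ck_on_Suc_has_derivative[OF Suc.prems]]])
       (use Suc in auto)
qed

lemma Ck_on_add:
  assumes "open S" "Ck_on k S f" "Ck_on k S g"
  shows "Ck_on k S (\<lambda>x. f x + g x)"
  using assms(2,3)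
proof (induction k arbitrary: f g)
  case 0
  then show ?case by (simp add: continuous_on_add)
next
  case (Suc k)
  show ?case
    by (rule Ck_on_SucI[OF assms(1)
          has_derivative_add[OF Ck_on_Suc_has_derivative[OF Suc.prems(1)]
             Ck_on_Suc_has_derivative[OF Suc.prems(2)]]])
       (use Suc in auto)
qed

text \<open>The product rule writes the derivative as a sum of two products of maps of class one lower,
  to which the induction hypothesis applies.\<close>

lemma Ck_on_bilinear:
  assumes "open S" "bounded_bilinear B" "Ck_on k S f" "Ck_on k S g"
  shows "Ck_on k S (\<lambda>x. B (f x) (g x))"
  using assms(3,4)
proof (induction k arbitrary: f g)
  case 0
  then show ?case by (simp add: bounded_bilinear.continuous_on[OF assms(2)])
next
  case (Suc k)
  note f = Suc.prems(1) and g = Suc.prems(2)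
  show ?case
  proof (rule Ck_on_SucI[OF assms(1)])
    fix x assume "x \<in> S"
    then show "((\<lambda>x. B (f x) (g x)) has_derivative
        (\<lambda>v. B (f x) (frechet_derivative g (at x) v) + B (frechet_derivative f (at x) v) (g x))) (at x)"
      by (intro bounded_bilinear.FDERIV[OF assms(2)] Ck_on_Suc_has_derivative[OF f]
            Ck_on_Suc_has_derivative[OF g])
  next
    fix v
    show "Ck_on k S (\<lambda>x. B (f x) (frechet_derivative g (at x) v)
                        + B (frechet_derivative f (at x) v) (g x))"
      using f g Ck_on_Suc_imp[OF f] Ck_on_Suc_imp[OF g]
      by (intro Ck_on_add assms(1) Suc.IH) auto
  qed
qed

lemma Ck_on_sum:
  assumes "open S" "\<And>i. i \<in> I \<Longrightarrow> Ck_on k S (f i)"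
  shows "Ck_on k S (\<lambda>x. \<Sum>i\<in>I. f i x)"
  using assms(2)
  by (induction I rule: infinite_finite_induct) (simp_all add: Ck_on_const Ck_on_add assms(1))

lemma Ck_on_mult:
  fixes f g :: "'a::real_normed_vector \<Rightarrow> real"
  assumes "open S" "Ck_on k S f" "Ck_on k S g"
  shows "Ck_on k S (\<lambda>x. f x * g x)"
  by (rule Ck_on_bilinear[OF assms(1) bounded_bilinear_mult assms(2,3)])

lemma Ck_on_prod:
  fixes f :: "'i \<Rightarrow> 'a::real_normed_vector \<Rightarrow> real"
  assumes "open S" "\<And>i. i \<in> I \<Longrightarrow> Ck_on k S (f i)"
  shows "Ck_on k S (\<lambda>x. \<Prod>i\<in>I. f i x)"
  using assms(2)
  by (induction I rule: infinite_finite_induct) (simp_all add: Ck_on_const Ck_on_mult assms(1))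

lemma Ck_on_componentwise:
  fixes f :: "'a::real_normed_vector \<Rightarrow> real^'n"
  assumes "open S" "\<And>i. Ck_on k S (\<lambda>x. f x $ i)"
  shows "Ck_on k S f"
proof -
  have "Ck_on k S (\<lambda>x. \<Sum>i\<in>UNIV. (f x $ i) *\<^sub>R axis i 1)"
    by (intro Ck_on_sum assms(1) Ck_on_linear[OF assms(1) bounded_linear_scaleR_left assms(2)])
  then show ?thesis
    by (rule Ck_on_cong[OF assms(1), rotated])
       (simp add: vec_eq_iff axis_def if_distrib cong: if_cong)
qed

lemma Ck_on_component:
  fixes f :: "'a::real_normed_vector \<Rightarrow> real^'n"
  assumes "open S" "Ck_on k S f"
  shows "Ck_on k S (\<lambda>x. f x $ i)"
  by (rule Ck_on_linear[OF assms(1) bounded_linear_vec_nth assms(2)])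

text \<open>The chain rule gives \<open>Df (g x) (Dg x v)\<close>, in which the direction of differentiation of \<open>f\<close>
  varies with \<open>x\<close>, whereas \<open>Ck_on\<close> only speaks about fixed directions. Expanding \<open>Dg x v\<close> in a basis
  makes the directions constant; this is where the finite dimension of the middle space enters.\<close>

lemma Ck_on_compose:
  fixes f :: "'b::euclidean_space \<Rightarrow> 'c::real_normed_vector"
  assumes S: "open S" and T: "open T" and sub: "g ` S \<subseteq> T"
    and "Ck_on k T f" "Ck_on k S g"
  shows "Ck_on k S (\<lambda>x. f (g x))"
  using assms(4,5)
proof (induction k arbitrary: f)
  case 0
  then show ?case using continuous_on_compose2[OF _ _ sub] by simp
next
  case (Suc k)
  note f = Suc.prems(1) and g = Suc.prems(2)
  show ?case
  proof (rule Ck_on_SucI[OF S])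
    fix x assume x: "x \<in> S"
    let ?f' = "frechet_derivative f (at (g x))" and ?g' = "frechet_derivative g (at x)"
    have f': "(f has_derivative ?f') (at (g x))"
      using Ck_on_Suc_has_derivative[OF f] sub x by auto
    have g': "(g has_derivative ?g') (at x)"
      using Ck_on_Suc_has_derivative[OF g x] .
    have "?f' (?g' v) = (\<Sum>b\<in>Basis. (?g' v \<bullet> b) *\<^sub>R ?f' b)" for v
    proof -
      have "?f' (\<Sum>b\<in>Basis. (?g' v \<bullet> b) *\<^sub>R b) = (\<Sum>b\<in>Basis. (?g' v \<bullet> b) *\<^sub>R ?f' b)"
        using has_derivative_linear[OF f'] by (simp add: linear_sum linear_scale)
      then show ?thesis by (simp only: euclidean_representation)
    qed
    with has_derivative_compose[OF g' f']
    show "((\<lambda>x. f (g x)) has_derivative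
            (\<lambda>v. \<Sum>b\<in>Basis. (?g' v \<bullet> b) *\<^sub>R ?f' b)) (at x)"
      by simp
  next
    fix v
    show "Ck_on k S (\<lambda>x. \<Sum>b\<in>Basis. (frechet_derivative g (at x) v \<bullet> b) *\<^sub>R
                            frechet_derivative f (at (g x)) b)"
      using f g Ck_on_Suc_imp[OF g]
      by (intro Ck_on_sum S Ck_on_bilinear[OF S bounded_bilinear_scaleR] Suc.IH
           Ck_on_linear[OF S bounded_linear_inner_left]) auto
  qed
qed

text \<open>The derivative of \<open>inverse\<close> is a polynomial in \<open>inverse\<close>, hence as smooth as \<open>inverse\<close>
  is already known to be.\<close>

lemma Ck_on_inverse_real: "Ck_on k (- {0::real}) inverse"
proof (induction k)
  case 0
  show ?case by (auto intro!: continuous_intros)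
next
  case (Suc k)
  have o: "open (- {0::real})" by (simp add: open_Compl)
  show ?case
  proof (rule Ck_on_SucI[OF o])
    fix x :: real assume "x \<in> - {0}"
    then show "(inverse has_derivative (\<lambda>v. (inverse x * inverse x) * (- v))) (at x)"
      using has_derivative_inverse'[of x UNIV] by (simp add: algebra_simps)
  next
    fix v :: real
    show "Ck_on k (- {0}) (\<lambda>x. (inverse x * inverse x) * (- v))"
      by (intro Ck_on_mult o Suc Ck_on_const)
  qed
qed

lemma Ck_on_divide:
  fixes f g :: "'a::real_normed_vector \<Rightarrow> real"
  assumes "open S" "Ck_on k S f" "Ck_on k S g" "\<And>x. x \<in> S \<Longrightarrow> g x \<noteq> 0"
  shows "Ck_on k S (\<lambda>x. f x / g x)"
  unfolding divide_inverse
  by (rule Ck_on_mult[OF assms(1,2) Ck_on_compose[OF assms(1) _ _ Ck_on_inverse_real assms(3)]])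
     (use assms(4) in auto)

lemma Ck_on_det:
  fixes A :: "'a::real_normed_vector \<Rightarrow> real^'n^'n"
  assumes "open S" "\<And>i j. Ck_on k S (\<lambda>x. A x $ i $ j)"
  shows "Ck_on k S (\<lambda>x. det (A x))"
  unfolding det_def
  by (intro Ck_on_sum Ck_on_mult Ck_on_const Ck_on_prod assms)

lemma smooth_onD: "smooth_on S f \<Longrightarrow> Ck_on k S f"
  by (simp add: smooth_on_def)

lemma smooth_on_subset: "smooth_on S f \<Longrightarrow> T \<subseteq> S \<Longrightarrow> smooth_on T f"
  using Ck_on_subset unfolding smooth_on_def by blast

lemma smooth_on_has_derivative:
  "smooth_on S f \<Longrightarrow> x \<in> S \<Longrightarrow> (f has_derivative frechet_derivative f (at x)) (at x)"
  using Ck_on_Suc_has_derivative smooth_onD by blast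

lemma smooth_on_frechet_derivative:
  "smooth_on S f \<Longrightarrow> smooth_on S (\<lambda>x. frechet_derivative f (at x) v)"
  unfolding smooth_on_def by (metis Ck_on.simps(2))

section \<open>The smooth inverse function theorem\<close>

lemma jacobian_mult_vec:
  fixes f :: "real^'m \<Rightarrow> real^'n"
  assumes "f differentiable (at x)"
  shows "jacobian f (at x) *v v = frechet_derivative f (at x) v"
  using frechet_derivative_at[OF iffD1[OF jacobian_works assms]] by metis

text \<open>Bootstrapping: the directional derivatives of \<open>g\<close> solve a linear system whose coefficients are the
  entries of the Jacobian matrix of \<open>f\<close> at \<open>g y\<close>. By Cramer's rule they are rational functions of
  these entries, so if \<open>g\<close> is of class \<open>C\<^sup>k\<close>, its derivatives are too and \<open>g\<close> is of class \<open>C\<^sup>k\<^sup>+\<^sup>1\<close>.\<close>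

lemma smooth_inverse:
  fixes f g :: "real^'n \<Rightarrow> real^'n"
  assumes "open U" "open V" "smooth_on U f" "g ` V \<subseteq> U"
    and g': "\<And>y. y \<in> V \<Longrightarrow> (g has_derivative g' y) (at y)"
    and inv: "\<And>y v. y \<in> V \<Longrightarrow> frechet_derivative f (at (g y)) (g' y v) = v"
    and det: "\<And>y. y \<in> V \<Longrightarrow> det (jacobian f (at (g y))) \<noteq> 0"
  shows "smooth_on V g"
  unfolding smooth_on_def
proof
  fix k
  show "Ck_on k V g"
  proof (induction k)
    case 0
    show ?case
      using g' by (auto intro!: continuous_at_imp_continuous_on has_derivative_continuous)
  next
    case (Suc k)
    let ?J = "\<lambda>y. jacobian f (at (g y))"
    have J: "Ck_on k V (\<lambda>y. ?J y $ i $ j)" for i j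
    proof -
      have "Ck_on k U (\<lambda>x. frechet_derivative f (at x) (axis j 1))"
        using smooth_onD[OF smooth_on_frechet_derivative] assms(3) by blast
      then have "Ck_on k V (\<lambda>y. frechet_derivative f (at (g y)) (axis j 1))"
        using Ck_on_compose[OF assms(2,1,4)] Suc by blast
      then show ?thesis
        using Ck_on_component[OF assms(2)] by (fastforce simp: jacobian_def matrix_def)
    qed
    show ?case
    proof (rule Ck_on_SucI[OF assms(2)])
      fix y assume y: "y \<in> V"
      have "g' y v $ k =
            det (\<chi> i j. if j = k then v $ i else ?J y $ i $ j) / det (?J y)" for v k
      proof -
        have "f differentiable at (g y)"
          using y assms(4) smooth_on_has_derivative[OF assms(3)] by (auto simp: differentiable_def)
        then have "?J y *v g' y v = v"
          using inv[OF y] by (simp add: jacobian_mult_vec)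
        then show ?thesis
          using cramer[OF det[OF y]] by (simp add: vec_eq_iff)
      qed
      then have "g' y = (\<lambda>v. \<chi> k. det (\<chi> i j. if j = k then v $ i else ?J y $ i $ j) / det (?J y))"
        by (auto simp: vec_eq_iff)
      then show "(g has_derivative
          (\<lambda>v. \<chi> k. det (\<chi> i j. if j = k then v $ i else ?J y $ i $ j) / det (?J y))) (at y)"
        using g'[OF y] by simp
    next
      fix v :: "real^'n"
      show "Ck_on k V (\<lambda>y. \<chi> k. det (\<chi> i j. if j = k then v $ i else ?J y $ i $ j) / det (?J y))"
      proof (rule Ck_on_componentwise[OF assms(2)])
        fix l
        have "Ck_on k V (\<lambda>y. (\<chi> i j. if j = l then v $ i else ?J y $ i $ j) $ i $ j)" for i j
          using J by (cases "j = l") (simp_all add: Ck_on_const assms(2))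
        then show "Ck_on k V (\<lambda>y. (\<chi> k. det (\<chi> i j. if j = k then v $ i else ?J y $ i $ j) / det (?J y)) $ l)"
          using det by (simp add: Ck_on_divide Ck_on_det J assms(2))
      qed
    qed
  qed
qed

text \<open>The \<open>C\<^sup>1\<close> inverse function theorem provides the local inverse, and
  \<open>smooth_inverse\<close> upgrades its regularity.\<close>

theorem smooth_inverse_function_theorem:
  fixes f :: "real^'n \<Rightarrow> real^'n"
  assumes "open U" "p \<in> U" "smooth_on U f"
    and inj: "inj (frechet_derivative f (at p))"
  obtains V W g where "open V" "p \<in> V" "V \<subseteq> U" "open W" "f p \<in> W" "homeomorphism V W f g"
    "smooth_on W g"
proof -
  define f' where "f' x = Blinfun (frechet_derivative f (at x))" for x
  have d: "(f has_derivative frechet_derivative f (at x)) (at x)" if "x \<in> U" for x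
    using smooth_on_has_derivative[OF assms(3) that] .
  have f': "blinfun_apply (f' x) = frechet_derivative f (at x)" if "x \<in> U" for x
    unfolding f'_def using has_derivative_bounded_linear[OF d[OF that]]
    by (simp add: bounded_linear_Blinfun_apply)
  have cont: "continuous_on U f'"
  proof (rule continuous_on_blinfun_componentwise)
    fix i :: "real^'n" 
    have "continuous_on U (\<lambda>x. frechet_derivative f (at x) i)"
      using smooth_onD[OF smooth_on_frechet_derivative[OF assms(3)], of 0] by simp
    then show "continuous_on U (\<lambda>x. blinfun_apply (f' x) i)"
      by (simp add: f' cong: continuous_on_cong)
  qed
  obtain L where L: "linear L" "L \<circ> frechet_derivative f (at p) = id"
    using linear_injective_left_inverse[OF has_derivative_linear[OF d[OF assms(2)]] inj] by blast
  have "Blinfun L o\<^sub>L f' p = id_blinfun"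
    using L f'[OF assms(2)]
    by (intro blinfun_eqI)
       (simp add: bounded_linear_Blinfun_apply linear_conv_bounded_linear o_def fun_eq_iff)
  then obtain V W g g' where VW: "open V" "V \<subseteq> U" "p \<in> V" "open W" "f p \<in> W" "homeomorphism V W f g"
    and g': "\<And>y. y \<in> W \<Longrightarrow> (g has_derivative (g' y)) (at y)"
    and inv: "\<And>y. y \<in> W \<Longrightarrow> g' y = Hilbert_Choice.inv (blinfun_apply (f' (g y)))"
    and bij: "\<And>y. y \<in> W \<Longrightarrow> bij (blinfun_apply (f' (g y)))"
    using inverse_function_theorem[OF assms(1) _ cont assms(2), of f] d f' by metis
  have gU: "g y \<in> U" if "y \<in> W" for y
    using that VW by (auto simp: homeomorphism_def)
  have "smooth_on W g"
  proof (rule smooth_inverse[OF assms(1) VW(4) assms(3) _ g'])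
    show "g ` W \<subseteq> U" using gU by auto
    fix y assume y: "y \<in> W"
    show "frechet_derivative f (at (g y)) (g' y v) = v" for v
      using inv[OF y] bij[OF y] f'[OF gU[OF y]] by (simp add: bij_is_surj surj_f_inv_f)
    have "f differentiable at (g y)" using d[OF gU[OF y]] by (auto simp: differentiable_def)
    then have "(*v) (jacobian f (at (g y))) = frechet_derivative f (at (g y))"
      by (auto simp: jacobian_mult_vec)
    then show "det (jacobian f (at (g y))) \<noteq> 0"
      using bij[OF y] f'[OF gU[OF y]] bij_is_inj det_eq_0_rank less_rank_noninjective by metis
  qed
  then show thesis using that VW by blast
qed

section \<open>Partial derivatives and integrals along segments\<close>

lemma frechet_derivative_component:
  fixes f :: "'a::real_normed_vector \<Rightarrow> real^'n"
  assumes "f differentiable (at p)"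
  shows "frechet_derivative (\<lambda>z. f z $ i) (at p) v = frechet_derivative f (at p) v $ i"
  using fun_cong[OF frechet_derivative_at[OF bounded_linear.has_derivative[OF bounded_linear_vec_nth
      assms[unfolded frechet_derivative_works]]]]
  by simp

lemma partial_deriv_component:
  fixes f :: "real^'m \<Rightarrow> real^'n"
  assumes "f differentiable (at p)"
  shows "partial_deriv i (\<lambda>z. f z $ j) p = partial_deriv i f p $ j"
  unfolding partial_deriv_def by (rule frechet_derivative_component[OF assms])

lemma partial_deriv_cong:
  assumes "open W" "p \<in> W" "\<And>q. q \<in> W \<Longrightarrow> f q = g q" "g differentiable (at p)"
  shows "partial_deriv i f p = partial_deriv i g p"
  using frechet_derivative_transform_within_open[of g p W f] assms
  by (simp add: partial_deriv_def)

lemma frechet_derivative_partial_derivs: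
  fixes f :: "real^2 \<Rightarrow> 'b::real_normed_vector"
  assumes "f differentiable (at p)"
  shows "frechet_derivative f (at p) w = w $ 1 *\<^sub>R partial_deriv 1 f p + w $ 2 *\<^sub>R partial_deriv 2 f p"
proof -
  have w: "w = w $ 1 *\<^sub>R axis 1 1 + w $ 2 *\<^sub>R axis 2 1"
    by (simp add: vec_eq_iff forall_2 axis_def)
  have "linear (frechet_derivative f (at p))"
    using linear_frechet_derivative[OF assms] .
  then show ?thesis
    by (subst w) (simp add: linear_add linear_scale partial_deriv_def)
qed

text \<open>The fundamental theorem of calculus for an oriented integral. Stating the hypotheses for
  \<open>\<bar>t\<bar> \<le> \<bar>s\<bar>\<close> avoids a case distinction on the sign of \<open>s\<close>, at the price of a segment that is
  symmetric about \<open>a\<close>.\<close>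

lemma integral_along_segment:
  fixes F :: "'a::real_normed_vector \<Rightarrow> real"
  assumes "open W" "smooth_on W F"
    and seg: "\<And>t. \<bar>t\<bar> \<le> \<bar>s\<bar> \<Longrightarrow> a + t *\<^sub>R d \<in> W"
    and g: "\<And>t. \<bar>t\<bar> \<le> \<bar>s\<bar> \<Longrightarrow> g t = frechet_derivative F (at (a + t *\<^sub>R d)) d"
  shows "(LBINT t=0..ereal s. g t) = F (a + s *\<^sub>R d) - F a"
proof -
  let ?I = "{min 0 s..max 0 s}"
  have I: "\<bar>t\<bar> \<le> \<bar>s\<bar>" if "t \<in> ?I" for t
    using that by auto
  have "(LBINT t=ereal 0..ereal s. g t) = F (a + s *\<^sub>R d) - F (a + 0 *\<^sub>R d)"
  proof (rule interval_integral_FTC_finite)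
    have "continuous_on W (\<lambda>q. frechet_derivative F (at q) d)"
      using smooth_onD[OF smooth_on_frechet_derivative[OF assms(2)], of 0] by simp
    then have "continuous_on ?I (\<lambda>t. frechet_derivative F (at (a + t *\<^sub>R d)) d)"
      by (rule continuous_on_compose2) (use seg[OF I] in \<open>auto intro!: continuous_intros\<close>)
    then show "continuous_on ?I g"
      by (rule continuous_on_eq) (use g[OF I] in simp)
    fix t assume "min 0 s \<le> t" "t \<le> max 0 s"
    then have t: "\<bar>t\<bar> \<le> \<bar>s\<bar>" by auto
    let ?D = "frechet_derivative F (at (a + t *\<^sub>R d))"
    have D: "(F has_derivative ?D) (at (a + t *\<^sub>R d))"
      using smooth_on_has_derivative[OF assms(2) seg[OF t]] .
    have "((\<lambda>t. a + t *\<^sub>R d) has_derivative (\<lambda>r. r *\<^sub>R d)) (at t)"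
      by (auto intro!: derivative_eq_intros)
    from has_derivative_compose[OF this D]
    have "((\<lambda>t. F (a + t *\<^sub>R d)) has_derivative (\<lambda>r. r *\<^sub>R ?D d)) (at t)"
      by (simp add: linear_scale[OF has_derivative_linear[OF D]])
    then show "((\<lambda>t. F (a + t *\<^sub>R d)) has_vector_derivative g t) (at t within ?I)"
      using g[OF t] by (simp add: has_vector_derivative_def has_derivative_at_withinI)
  qed
  then show ?thesis by (simp add: zero_ereal_def)
qed

section \<open>The Legendre transform and the normal form\<close>

text \<open>The hypothesis says \<open>dy\<^sub>3 = p\<^sub>1 dy\<^sub>1 + p\<^sub>2 dy\<^sub>2\<close>: the image of \<open>y\<close> has contact element of slope
  \<open>(p\<^sub>1, p\<^sub>2)\<close> at \<open>y p\<close>. Then \<open>h = p\<^sub>1 y\<^sub>1 + p\<^sub>2 y\<^sub>2 - y\<^sub>3\<close>, the Legendre transform of the third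
  coordinate, satisfies \<open>dh = y\<^sub>1 dp\<^sub>1 + y\<^sub>2 dp\<^sub>2\<close>, because the terms with \<open>dy\<^sub>i\<close> cancel.\<close>

lemma
  fixes y :: "real^2 \<Rightarrow> real^3"
  assumes W: "open W" "smooth_on W y"
    and contact: "\<And>p w. p \<in> W \<Longrightarrow> frechet_derivative y (at p) w $ 3 =
       p $ 1 * frechet_derivative y (at p) w $ 1 + p $ 2 * frechet_derivative y (at p) w $ 2"
  defines "h \<equiv> \<lambda>p. p $ 1 * y p $ 1 + p $ 2 * y p $ 2 - y p $ 3"
  shows smooth_on_legendre: "smooth_on W h"
    and partial_deriv_legendre: "p \<in> W \<Longrightarrow> partial_deriv 1 h p = y p $ 1"
      "p \<in> W \<Longrightarrow> partial_deriv 2 h p = y p $ 2"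
proof -
  have y: "Ck_on k W (\<lambda>p. y p $ i)" for k i
    by (rule Ck_on_component[OF W(1) smooth_onD[OF W(2)]])
  have "Ck_on k W (\<lambda>p. p $ 1 * y p $ 1 + p $ 2 * y p $ 2 + - (y p $ 3))" for k
    by (intro Ck_on_add Ck_on_mult y W(1) Ck_on_component[OF W(1) Ck_on_ident[OF W(1)]]
          Ck_on_linear[OF W(1) bounded_linear_minus[OF bounded_linear_ident]])
  then show "smooth_on W h"
    by (simp add: smooth_on_def h_def)
  have D: "frechet_derivative h (at p) w = w $ 1 * y p $ 1 + w $ 2 * y p $ 2" if p: "p \<in> W" for p w
  proof -
    let ?D = "frechet_derivative y (at p)"
    have i: "((\<lambda>p. y p $ i) has_derivative (\<lambda>w. ?D w $ i)) (at p)" for i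
      by (rule bounded_linear.has_derivative[OF bounded_linear_vec_nth smooth_on_has_derivative[OF W(2) p]])
    have j: "((\<lambda>p. p $ j) has_derivative (\<lambda>w. w $ j)) (at p)" for j :: 2
      by (rule bounded_linear.has_derivative[OF bounded_linear_vec_nth has_derivative_ident])
    have "(h has_derivative (\<lambda>w. p $ 1 * ?D w $ 1 + w $ 1 * y p $ 1
            + (p $ 2 * ?D w $ 2 + w $ 2 * y p $ 2) - ?D w $ 3)) (at p)"
      unfolding h_def
      by (intro has_derivative_diff has_derivative_add has_derivative_mult i j)
    from fun_cong[OF frechet_derivative_at[OF this], of w] contact[OF p, of w] show ?thesis
      by linarith
  qed
  show "p \<in> W \<Longrightarrow> partial_deriv 1 h p = y p $ 1" "p \<in> W \<Longrightarrow> partial_deriv 2 h p = y p $ 2"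
    by (simp_all add: partial_deriv_def D axis_def)
qed

text \<open>The first two coordinates agree by assumption on \<open>h\<close>. With \<open>h\<^sub>u = y\<^sub>1\<close> and \<open>h\<^sub>v = y\<^sub>2\<close> the contact
  condition turns the two integrands of the third coordinate into the derivative of \<open>y\<^sub>3\<close> along the
  horizontal segment from \<open>(0, v)\<close> to \<open>(u, v)\<close> and along the vertical segment from the origin to
  \<open>(0, v)\<close>, so the integrals add up to \<open>y\<^sub>3\<close>.\<close>

lemma wavefront_normal_form_eq:
  fixes y :: "real^2 \<Rightarrow> real^3"
  assumes W: "open W" "smooth_on W y" and "0 \<in> W" "y 0 = 0"
    and contact: "\<And>p w. p \<in> W \<Longrightarrow> frechet_derivative y (at p) w $ 3 =
       p $ 1 * frechet_derivative y (at p) w $ 1 + p $ 2 * frechet_derivative y (at p) w $ 2"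
    and h: "\<And>p. p \<in> W \<Longrightarrow> partial_deriv 1 h p = y p $ 1"
           "\<And>p. p \<in> W \<Longrightarrow> partial_deriv 2 h p = y p $ 2"
  shows "\<forall>\<^sub>F p in nhds 0. wavefront_normal_form h p = y p"
proof -
  obtain r where r: "r > 0" "ball 0 r \<subseteq> W"
    using W(1) \<open>0 \<in> W\<close> open_contains_ball by blast
  have diff: "y differentiable (at p)" if "p \<in> W" for p
    using smooth_on_has_derivative[OF W(2) that] by (auto simp: differentiable_def)
  have diffc: "(\<lambda>p. y p $ i) differentiable (at p)" if "p \<in> W" for p i
    using bounded_linear.has_derivative[OF bounded_linear_vec_nth smooth_on_has_derivative[OF W(2) that]]
    by (auto simp: differentiable_def)
  have s3: "smooth_on W (\<lambda>p. y p $ 3)"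
    using Ck_on_component[OF W(1)] W(2) by (auto simp: smooth_on_def)
  have hh: "partial_deriv i (partial_deriv 1 h) p = partial_deriv i y p $ 1"
       "partial_deriv i (partial_deriv 2 h) p = partial_deriv i y p $ 2"
    if "p \<in> W" for i p
    using partial_deriv_cong[OF W(1) that h(1) diffc[OF that]]
          partial_deriv_cong[OF W(1) that h(2) diffc[OF that]]
          partial_deriv_component[OF diff[OF that]]
    by simp_all
  have vec: "(vector [u, v] :: real^2) = u *\<^sub>R axis 1 1 + v *\<^sub>R axis 2 1" for u v :: real
    by (simp add: vec_eq_iff forall_2 axis_def)
  have "wavefront_normal_form h p = y p" if p: "p \<in> ball 0 r" for p
  proof -
    let ?u = "p $ 1" and ?v = "p $ 2"
    \<comment> \<open>Both segments of integration stay in the ball, which is closed under shrinking coordinates.\<close>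
    have inW: "vector [s, t] \<in> W" if "\<bar>s\<bar> \<le> \<bar>?u\<bar>" "\<bar>t\<bar> \<le> \<bar>?v\<bar>" for s t :: real
    proof -
      have "norm (vector [s, t] :: real^2) \<le> norm p"
      proof (rule norm_le_componentwise_cart)
        show "norm ((vector [s, t] :: real^2) $ i) \<le> norm (p $ i)" for i
          using that exhaust_2[of i] by auto
      qed
      then show ?thesis using p r by auto
    qed
    have "(LBINT t=0..ereal ?u. t * partial_deriv 1 (partial_deriv 1 h) (vector [t, ?v])
            + ?v * partial_deriv 1 (partial_deriv 2 h) (vector [t, ?v]))
        = y (?v *\<^sub>R axis 2 1 + ?u *\<^sub>R axis 1 1) $ 3 - y (?v *\<^sub>R axis 2 1) $ 3"
    proof (rule integral_along_segment[OF W(1) s3])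
      fix t assume "\<bar>t\<bar> \<le> \<bar>?u\<bar>"
      then have q: "vector [t, ?v] \<in> W" using inW by simp
      have q_eq: "?v *\<^sub>R axis 2 1 + t *\<^sub>R axis 1 1 = (vector [t, ?v] :: real^2)"
        by (simp add: vec)
      show "?v *\<^sub>R axis 2 1 + t *\<^sub>R axis 1 1 \<in> W"
        using q by (simp only: q_eq)
      show "t * partial_deriv 1 (partial_deriv 1 h) (vector [t, ?v])
            + ?v * partial_deriv 1 (partial_deriv 2 h) (vector [t, ?v])
          = frechet_derivative (\<lambda>p. y p $ 3) (at (?v *\<^sub>R axis 2 1 + t *\<^sub>R axis 1 1)) (axis 1 1)"
        using contact[OF q, of "axis 1 1"] hh[OF q, of 1] frechet_derivative_component[OF diff[OF q], of 3]
        by (simp only: q_eq) (simp add: partial_deriv_def[of _ y])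
    qed
    moreover
    have "(LBINT t=0..ereal ?v. t * partial_deriv 2 (partial_deriv 2 h) (vector [0, t]))
        = y (0 + ?v *\<^sub>R axis 2 1) $ 3 - y 0 $ 3"
    proof (rule integral_along_segment[OF W(1) s3])
      fix t assume "\<bar>t\<bar> \<le> \<bar>?v\<bar>"
      then have q: "vector [0, t] \<in> W" using inW by simp
      have q_eq: "0 + t *\<^sub>R axis 2 1 = (vector [0, t] :: real^2)"
        by (simp add: vec)
      show "0 + t *\<^sub>R axis 2 1 \<in> W"
        using q by (simp only: q_eq)
      show "t * partial_deriv 2 (partial_deriv 2 h) (vector [0, t])
          = frechet_derivative (\<lambda>p. y p $ 3) (at (0 + t *\<^sub>R axis 2 1)) (axis 2 1)"
        using contact[OF q, of "axis 2 1"] hh[OF q, of 2] frechet_derivative_component[OF diff[OF q], of 3]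
        by (simp only: q_eq) (simp add: partial_deriv_def[of _ y])
    qed
    moreover have "?v *\<^sub>R axis 2 1 + ?u *\<^sub>R axis 1 1 = p"
      by (simp add: vec_eq_iff forall_2 axis_def)
    moreover have "p \<in> W" using p r by auto
    ultimately show ?thesis
      using \<open>y 0 = 0\<close> h
      by (simp add: wavefront_normal_form_def Let_def vec_eq_iff forall_3)
  qed
  then show ?thesis
    using r(1) by (intro eventually_nhds_in_open[of "ball 0 r" 0, THEN eventually_mono]) auto
qed

section \<open>The slope of the normal as a chart\<close>

text \<open>The chart \<open>\<phi>\<close> is the Gauss map in the affine coordinates given by central projection to the plane of
  height \<open>-1\<close>: \<open>m\<close> is proportional to \<open>(\<phi>\<^sub>1, \<phi>\<^sub>2, -1)\<close>. At the origin the tangent plane of the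
  sphere is horizontal, so \<open>D\<phi>\<close> is, up to sign, the horizontal part of \<open>Dm\<close> and loses no
  information.\<close>

lemma normal_slope_chart:
  fixes m :: "real^2 \<Rightarrow> real^3"
  assumes "open V" "0 \<in> V" "smooth_on V m"
    and unit: "\<And>p. p \<in> V \<Longrightarrow> norm (m p) = 1" and m0: "m 0 = axis 3 1"
    and inj: "inj (frechet_derivative m (at 0))"
  obtains V' W and \<phi> \<psi> :: "real^2 \<Rightarrow> real^2"
  where "open V'" "0 \<in> V'" "V' \<subseteq> V" "open W" "homeomorphism V' W \<phi> \<psi>"
    "smooth_on V' \<phi>" "smooth_on W \<psi>" "\<phi> 0 = 0"
    "\<And>p. p \<in> V' \<Longrightarrow> m p $ 3 \<noteq> 0"
    "\<And>p. p \<in> V' \<Longrightarrow> m p $ 1 = - (\<phi> p $ 1 * m p $ 3)"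
    "\<And>p. p \<in> V' \<Longrightarrow> m p $ 2 = - (\<phi> p $ 2 * m p $ 3)"
proof -
  define \<phi> :: "real^2 \<Rightarrow> real^2" where "\<phi> p = vector [- m p $ 1 / m p $ 3, - m p $ 2 / m p $ 3]" for p
  define S where "S = {p \<in> V. m p $ 3 \<noteq> 0}"
  have "continuous_on V m"
    using smooth_onD[OF assms(3), of 0] by simp
  then have "open S"
    unfolding S_def
    using continuous_open_preimage[of V "\<lambda>p. m p $ 3" "- {0}"] \<open>open V\<close>
    by (auto simp: vimage_def Int_def open_Compl intro: continuous_on_component)
  have "0 \<in> S"
    by (simp add: S_def m0 assms(2))
  have mS: "smooth_on S m"
    by (rule smooth_on_subset[OF assms(3)]) (simp add: S_def)
  have comp: "Ck_on k S (\<lambda>p. m p $ i)" for k i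
    by (rule Ck_on_component[OF \<open>open S\<close> smooth_onD[OF mS]])
  have "Ck_on k S (\<lambda>p. - m p $ i / m p $ 3)" for k i
    by (intro Ck_on_divide \<open>open S\<close> comp Ck_on_linear[OF \<open>open S\<close> bounded_linear_minus[OF bounded_linear_ident]])
      (simp add: S_def)
  then have "Ck_on k S (\<lambda>p. \<phi> p $ i)" for k i
    using exhaust_2[of i] by (auto simp: \<phi>_def)
  then have smooth: "smooth_on S \<phi>"
    unfolding smooth_on_def using Ck_on_componentwise[OF \<open>open S\<close>] by blast
  have slope: "m p $ 1 = - (\<phi> p $ 1 * m p $ 3)" "m p $ 2 = - (\<phi> p $ 2 * m p $ 3)" if "p \<in> S" for p
    using that by (auto simp: \<phi>_def S_def)
  have \<phi>0: "\<phi> 0 = 0"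
    by (simp add: \<phi>_def m0 vec_eq_iff forall_2 axis_def)
  let ?m' = "frechet_derivative m (at 0)" and ?\<phi>' = "frechet_derivative \<phi> (at 0)"
  have m': "(m has_derivative ?m') (at 0)" and \<phi>': "(\<phi> has_derivative ?\<phi>') (at 0)"
    using smooth_on_has_derivative \<open>0 \<in> S\<close> mS smooth by blast+
  have m'i: "((\<lambda>p. m p $ i) has_derivative (\<lambda>w. ?m' w $ i)) (at 0)" for i
    by (rule bounded_linear.has_derivative[OF bounded_linear_vec_nth m'])
  have \<phi>'i: "((\<lambda>p. \<phi> p $ i) has_derivative (\<lambda>w. ?\<phi>' w $ i)) (at 0)" for i
    by (rule bounded_linear.has_derivative[OF bounded_linear_vec_nth \<phi>'])
  \<comment> \<open>In the product rule the term with \<open>\<phi> 0 = 0\<close> drops out, and \<open>m\<^sub>3\<close> is \<open>1\<close> at the origin.\<close>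
  have slope': "?m' w $ i = - (?\<phi>' w $ j)" if "\<And>p. p \<in> S \<Longrightarrow> m p $ i = - (\<phi> p $ j * m p $ 3)" for w i j
  proof -
    have "((\<lambda>p. - (\<phi> p $ j * m p $ 3)) has_derivative
            (\<lambda>w. - (\<phi> 0 $ j * ?m' w $ 3 + ?\<phi>' w $ j * m 0 $ 3))) (at 0)"
      by (intro has_derivative_minus has_derivative_mult m'i \<phi>'i)
    then have "((\<lambda>p. m p $ i) has_derivative
            (\<lambda>w. - (\<phi> 0 $ j * ?m' w $ 3 + ?\<phi>' w $ j * m 0 $ 3))) (at 0)"
      by (rule has_derivative_transform_within_open[OF _ \<open>open S\<close> \<open>0 \<in> S\<close>]) (simp add: that)
    from has_derivative_unique[OF m'i this] show ?thesis
      by (simp add: \<phi>0 m0 fun_eq_iff)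
  qed
  \<comment> \<open>Differentiating \<open>m \<bullet> m = 1\<close> shows that \<open>Dm\<close> takes values orthogonal to \<open>m\<close>.\<close>
  have unit': "?m' w $ 3 = 0" for w
  proof -
    have "((\<lambda>p. m p \<bullet> m p) has_derivative (\<lambda>w. m 0 \<bullet> ?m' w + ?m' w \<bullet> m 0)) (at 0)"
      by (rule has_derivative_inner[OF m' m'])
    moreover have "((\<lambda>p. m p \<bullet> m p) has_derivative (\<lambda>w. 0)) (at 0)"
      by (rule has_derivative_transform_within_open[OF has_derivative_const[of 1] assms(1,2)])
         (simp add: unit dot_square_norm)
    ultimately have "m 0 \<bullet> ?m' w + ?m' w \<bullet> m 0 = 0"
      using has_derivative_unique by (metis (no_types, lifting))
    then show ?thesis by (simp add: m0 inner_axis' inner_commute)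
  qed
  have "inj ?\<phi>'"
  proof (subst linear_injective_0[OF has_derivative_linear[OF \<phi>']], intro allI impI)
    fix w assume "?\<phi>' w = 0"
    then have "?m' w = 0"
      using slope'[of 1 1 w] slope'[of 2 2 w] slope unit'[of w]
      by (simp add: vec_eq_iff forall_3)
    then show "w = 0"
      using inj linear_injective_0[OF has_derivative_linear[OF m']] by blast
  qed
  then obtain V' W \<psi> where "open V'" "0 \<in> V'" "V' \<subseteq> S" "open W" "homeomorphism V' W \<phi> \<psi>"
      "smooth_on W \<psi>"
    using smooth_inverse_function_theorem[OF \<open>open S\<close> \<open>0 \<in> S\<close> smooth] by metis
  moreover from this have "smooth_on V' \<phi>" "V' \<subseteq> V"
    using smooth_on_subset[OF smooth] by (auto simp: S_def)
  ultimately show thesis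
    using that[of V' W \<phi> \<psi>] slope \<phi>0 S_def by blast
qed

section \<open>Wavefronts of rank zero\<close>

theorem theorem4p2:
  fixes U :: "(real^2) set"
    and x :: "real^2 \<Rightarrow> real^3"
    and \<Omega> :: "real^2 \<Rightarrow> real^2^3"
  assumes "open U" and "0 \<in> U" and "x 0 = 0"
    and "wavefront_on U x"
    and "tangent_moving_basis U x \<Omega>"
    and "0 \<in> singular_set U x"
    and "rank (jacobian x (at 0)) = 0"
  shows "\<exists>(T :: real^3 \<Rightarrow> real^3) (h :: real^2 \<Rightarrow> real) N.
           isometry T \<and>
           open N \<and> 0 \<in> N \<and> smooth_on N h \<and>
           partial_deriv 1 (partial_deriv 1 h) 0 = 0 \<and>
           partial_deriv 2 (partial_deriv 1 h) 0 = 0 \<and>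
           partial_deriv 2 (partial_deriv 2 h) 0 = 0 \<and>
           R_equivalent 0 (T \<circ> x) (wavefront_normal_form h)"
proof -
  obtain V n where V: "open V" "0 \<in> V" "V \<subseteq> U"
    and n: "unit_normal_field_on V x n" and imm: "immersion_on V (\<lambda>z. (x z, n z))"
    using assms(2,4) unfolding wavefront_on_def by blast
  have sx: "smooth_on V x"
    using assms(4) V(3) smooth_on_subset by (auto simp: wavefront_on_def)
  have sn: "smooth_on V n" and n1: "\<And>p. p \<in> V \<Longrightarrow> norm (n p) = 1"
    using n by (auto simp: unit_normal_field_on_def)
  have dx: "(x has_derivative frechet_derivative x (at p)) (at p)" if "p \<in> V" for p
    by (rule smooth_on_has_derivative[OF sx that])
  have dn: "(n has_derivative frechet_derivative n (at p)) (at p)" if "p \<in> V" for p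
    by (rule smooth_on_has_derivative[OF sn that])
  have normal: "n p \<bullet> frechet_derivative x (at p) w = 0" if "p \<in> V" for p w
    using n that frechet_derivative_partial_derivs[OF differentiableI[OF dx[OF that]], of w]
    by (simp add: unit_normal_field_on_def orthogonal_def inner_add_right)
  have x0: "frechet_derivative x (at 0) w = 0" for w
    using assms(7) jacobian_mult_vec[OF differentiableI[OF dx[OF V(2)]], of w]
    by (simp add: rank_eq_0)
  \<comment> \<open>As \<open>Dx\<close> vanishes at the origin, the whole immersion property is carried by the normal.\<close>
  have injn: "inj (frechet_derivative n (at 0))"
  proof -
    have "frechet_derivative (\<lambda>z. (x z, n z)) (at 0)
            = (\<lambda>w. (frechet_derivative x (at 0) w, frechet_derivative n (at 0) w))"
      using frechet_derivative_at[OF has_derivative_Pair[OF dx[OF V(2)] dn[OF V(2)]]] by simp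
    moreover have "inj (frechet_derivative (\<lambda>z. (x z, n z)) (at 0))"
      using imm V(2) by (auto simp: immersion_on_def immersive_at_def)
    ultimately show ?thesis
      by (simp add: inj_def x0)
  qed
  \<comment> \<open>The normal at the origin is made vertical, so that nearby tangent planes are graphs.\<close>
  obtain T :: "real^3 \<Rightarrow> real^3" where T: "orthogonal_transformation T" "T (n 0) = axis 3 1"
    using orthogonal_transformation_exists[of "n 0" "axis 3 1 :: real^3"] n1[OF V(2)] by auto
  have blT: "bounded_linear T"
    using orthogonal_transformation_linear[OF T(1)] by (simp add: linear_conv_bounded_linear)
  have "isometry T"
    using orthogonal_transformation_surj[OF T(1)] orthogonal_transformation_isometry T(1)
    by (auto simp: isometry_def)
  define m where "m p = T (n p)" for p
  have sm: "smooth_on V m"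
    unfolding m_def smooth_on_def using Ck_on_linear[OF V(1) blT smooth_onD[OF sn]] by blast
  have injm: "inj (frechet_derivative m (at 0))"
  proof -
    have "frechet_derivative m (at 0) = T \<circ> frechet_derivative n (at 0)"
      using frechet_derivative_at[OF bounded_linear.has_derivative[OF blT dn[OF V(2)]]]
      by (simp add: m_def[abs_def] o_def)
    then show ?thesis
      using injn orthogonal_transformation_inj[OF T(1)] by (simp add: inj_compose)
  qed
  obtain V' W and \<phi> \<psi> :: "real^2 \<Rightarrow> real^2" where V': "open V'" "0 \<in> V'" "V' \<subseteq> V" and W: "open W"
    and hom: "homeomorphism V' W \<phi> \<psi>" and s\<phi>: "smooth_on V' \<phi>" and s\<psi>: "smooth_on W \<psi>"
    and \<phi>0: "\<phi> 0 = 0"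
    and m3: "\<And>p. p \<in> V' \<Longrightarrow> m p $ 3 \<noteq> 0"
    and m1: "\<And>p. p \<in> V' \<Longrightarrow> m p $ 1 = - (\<phi> p $ 1 * m p $ 3)"
    and m2: "\<And>p. p \<in> V' \<Longrightarrow> m p $ 2 = - (\<phi> p $ 2 * m p $ 3)"
  proof (rule normal_slope_chart[OF V(1,2) sm])
    show "norm (m p) = 1" if "p \<in> V" for p
      using n1[OF that] T(1) by (simp add: m_def orthogonal_transformation_norm)
    show "m 0 = axis 3 1" by (simp add: m_def T(2))
  qed (use injm in auto)
  have \<psi>: "\<psi> q \<in> V'" "\<phi> (\<psi> q) = q" if "q \<in> W" for q
    using hom that by (auto simp: homeomorphism_def)
  have "0 \<in> W" and \<psi>0: "\<psi> 0 = 0"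
    using hom V'(2) \<phi>0 by (force simp: homeomorphism_def)+
  define y where "y q = T (x (\<psi> q))" for q
  have "Ck_on k W (\<lambda>q. x (\<psi> q))" for k
    by (rule Ck_on_compose[OF W V(1) _ smooth_onD[OF sx] smooth_onD[OF s\<psi>]])
       (use \<psi>(1) V'(3) in auto)
  then have sy: "smooth_on W y"
    unfolding y_def smooth_on_def using Ck_on_linear[OF W blT] by blast
  have dy: "frechet_derivative y (at q) w = T (frechet_derivative x (at (\<psi> q)) (frechet_derivative \<psi> (at q) w))"
    if "q \<in> W" for q w
  proof -
    have "\<psi> q \<in> V" using \<psi>(1)[OF that] V'(3) by auto
    from fun_cong[OF frechet_derivative_at[OF bounded_linear.has_derivative[OF blT
          has_derivative_compose[OF smooth_on_has_derivative[OF s\<psi> that] dx[OF this]]]], of w]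
    show ?thesis by (simp add: y_def[abs_def])
  qed
  \<comment> \<open>The normal \<open>m (\<psi> q)\<close>, proportional to \<open>(q\<^sub>1, q\<^sub>2, -1)\<close>, is orthogonal to the image of \<open>Dy\<close>.\<close>
  have contact: "frechet_derivative y (at q) w $ 3 =
       q $ 1 * frechet_derivative y (at q) w $ 1 + q $ 2 * frechet_derivative y (at q) w $ 2"
    if q: "q \<in> W" for q w
  proof -
    let ?Y = "frechet_derivative y (at q) w" and ?m = "m (\<psi> q)"
    have "?m \<bullet> ?Y = 0"
      using T(1) normal \<psi>(1)[OF q] V'(3) by (auto simp: dy[OF q] m_def orthogonal_transformation_def)
    then have "?m $ 1 * ?Y $ 1 + ?m $ 2 * ?Y $ 2 + ?m $ 3 * ?Y $ 3 = 0"
      by (simp add: inner_vec_def sum_3)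
    then have "?m $ 3 * (?Y $ 3 - (q $ 1 * ?Y $ 1 + q $ 2 * ?Y $ 2)) = 0"
      using m1[OF \<psi>(1)[OF q]] m2[OF \<psi>(1)[OF q]] \<psi>(2)[OF q] by (simp add: algebra_simps)
    then show ?thesis using m3[OF \<psi>(1)[OF q]] by simp
  qed
  define h :: "real^2 \<Rightarrow> real" where "h = (\<lambda>p. p $ 1 * y p $ 1 + p $ 2 * y p $ 2 - y p $ 3)"
  have sh: "smooth_on W h"
    unfolding h_def by (rule smooth_on_legendre[OF W sy contact])
  have h: "partial_deriv 1 h p = y p $ 1" "partial_deriv 2 h p = y p $ 2" if "p \<in> W" for p
    unfolding h_def using partial_deriv_legendre[OF W sy contact that] by blast+
  have y0: "frechet_derivative y (at 0) w = 0" for w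
    using dy[OF \<open>0 \<in> W\<close>] x0 \<psi>0 linear_0[OF orthogonal_transformation_linear[OF T(1)]] by simp
  have dy0: "y differentiable (at 0)"
    using smooth_on_has_derivative[OF sy \<open>0 \<in> W\<close>] by (auto simp: differentiable_def)
  have second: "partial_deriv i (\<lambda>p. y p $ j) 0 = 0" for i j
    by (simp add: partial_deriv_def frechet_derivative_component[OF dy0] y0)
  have dyc: "(\<lambda>p. y p $ j) differentiable (at 0)" for j
    using bounded_linear.has_derivative[OF bounded_linear_vec_nth smooth_on_has_derivative[OF sy \<open>0 \<in> W\<close>]]
    by (auto simp: differentiable_def)
  have "partial_deriv i (partial_deriv 1 h) 0 = 0" "partial_deriv i (partial_deriv 2 h) 0 = 0" for i
    using partial_deriv_cong[OF W \<open>0 \<in> W\<close> h(1) dyc] partial_deriv_cong[OF W \<open>0 \<in> W\<close> h(2) dyc] second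
    by simp_all
  moreover have "R_equivalent 0 (T \<circ> x) (wavefront_normal_form h)"
    unfolding R_equivalent_def
  proof (intro exI conjI)
    show "diffeo_germ 0 \<psi>"
      unfolding diffeo_germ_def
      using \<psi>0 W \<open>0 \<in> W\<close> V'(1) hom s\<phi> s\<psi> homeomorphism_symD by blast
    have "y 0 = 0"
      by (simp add: y_def \<psi>0 assms(3) linear_0[OF orthogonal_transformation_linear[OF T(1)]])
    from wavefront_normal_form_eq[OF W sy \<open>0 \<in> W\<close> this contact h]
    show "\<forall>\<^sub>F z in nhds 0. wavefront_normal_form h z = (T \<circ> x) (\<psi> z)"
      by (simp add: y_def)
  qed
  ultimately show ?thesis
    using \<open>isometry T\<close> W \<open>0 \<in> W\<close> sh by blast
qed

end
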